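(* Let $M\ge 1$ (with $M=1$ the shallow water equations and general $M$ the multilayer shallow water equations). For the hydrostatic reconstruction defined in the context, the volume integral of the nonconservative term vanishes in every cell, $$\int_{E_i}\boldsymbol{\phi}_\epsilon\circ\partial_x\mathbf r_\epsilon\,dx=0 ,$$ so that the hydrostatic reconstruction scheme $$\frac{d}{dt}\mathbf u_i=-\frac1{\Delta x}\oint_{\partial E_i}\big(\mathbf f^*_\epsilon+(\boldsymbol\phi\circ\mathbf r)^{\diamond}_\epsilon\big)\cdot\vec n\,dS-\frac1{\Delta x}\int_{E_i}\boldsymbol\phi_\epsilon\circ\partial_x\mathbf r_\epsilon\,dx$$ simplifies to $$\frac{d}{dt}\mathbf u_i=-\frac1{\Delta x}\oint_{\partial E_i}\big(\mathbf f^*_\epsilon+(\boldsymbol\phi\circ\mathbf r)^{\diamond}_\epsilon\big)\cdot\vec n\,dS .$$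
   Context: Constants: $g>0$, layer densities $0<\rho_1<\dots<\rho_M$ (layers counted from top to bottom), $\sigma_{km}=\rho_k/\rho_m$. The multilayer shallow water equations are, for $m=1,\dots,M$, $\partial_t h_m+\partial_x(h_mv_m)=0$ and $\partial_t(h_mv_m)+\partial_x(h_mv_m^2)=-gh_m\partial_x\big(b+\sum_{k\ge m}h_k+\sum_{k<m}\sigma_{km}h_k\big)$; for $M=1$ they are the shallow water equations. They are written $\mathbf u_t+\partial_x\mathbf f+\boldsymbol\phi\circ\partial_x\mathbf r=0$ ($\circ$ = Hadamard product), with layer components $\mathbf u_m=(h_m,h_mv_m)^T$, $\mathbf f_m=(h_mv_m,h_mv_m^2)^T$, $\boldsymbol\phi_m=g(0,h_m)^T$, $\mathbf r_m=\big(0,\,b+\sum_{k\ge m}h_k+\sum_{k<m}\sigma_{km}h_k\big)^T$. Grid and data: cells $E_i=[x_{i-1/2},x_{i+1/2}]$ of size $\Delta x$, with constant cell values $b_i\in\mathbb R$, $h_{m,i}\ge0$, $(v_m)_i\in\mathbb R$, and $H_{m,i}=b_i+\sum_{k\ge m}h_{k,i}$. At the interface $x_{i+1/2}$ the superscript $-$ denotes the values of cell $i$ and $+$ those of cell $i+1$. Hydrostatic reconstruction: at each interface set $b_\epsilon^{\pm}=\min\big(H_1^{\pm},\max(b^-,b^+)\big)$. For a small $\epsilon$ with $0<\epsilon<\Delta x/2$, split $E_i$ into $[x_{i-1/2},x_{i-1/2}+\epsilon]$, $[x_{i-1/2}+\epsilon,x_{i+1/2}-\epsilon]$, $[x_{i+1/2}-\epsilon,x_{i+1/2}]$.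 On the middle subcell $b_\epsilon(x)=b_i$; on the right subcell $b_\epsilon$ is linear from $b_i$ (at $x_{i+1/2}-\epsilon$) to $b_\epsilon^-$ of interface $x_{i+1/2}$; on the left subcell $b_\epsilon$ is linear from $b_\epsilon^+$ of interface $x_{i-1/2}$ (at $x_{i-1/2}$) to $b_i$. For $x\in E_i$: $H_{m,\epsilon}(x)=\max(H_{m,i},b_\epsilon(x))$; $h_{M,\epsilon}(x)=H_{M,\epsilon}(x)-b_\epsilon(x)$, $h_{m,\epsilon}(x)=H_{m,\epsilon}(x)-H_{m+1,\epsilon}(x)$ for $m<M$; $\mathbf u_{m,\epsilon}(x)=(h_{m,\epsilon}(x),h_{m,\epsilon}(x)(v_m)_i)^T$. $\boldsymbol\phi_\epsilon,\mathbf r_\epsilon$ denote $\boldsymbol\phi,\mathbf r$ evaluated with $h_{m,\epsilon},b_\epsilon$; these are piecewise linear in $x$ and the derivative is taken almost everywhere. Surface terms: $\mathbf f^*_\epsilon=\mathbf f^*(\mathbf u_\epsilon^-,\mathbf u_\epsilon^+)$ is a numerical flux and $(\boldsymbol\phi\circ\mathbf r)^\diamond_\epsilon$ a numerical nonconservative term, given for a cell with inner trace $-$ and outer trace $+$ by $\tfrac12\boldsymbol\phi_\epsilon^-\circ(\mathbf r_\epsilon^+-\mathbf r_\epsilon^-)$; $\vec n\in\{-1,1\}$ is the outward normal. *)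

theory Defs
  imports "HOL-Analysis.Analysis"
begin

text \<open>
  Layers are indexed by \<open>m \<in> {1..M}\<close> from top to bottom, cells by \<open>i :: int\<close>.
  \<open>xf i\<close> is the left face \<open>x\<^bsub>i-1/2\<^esub>\<close> of cell \<open>i\<close>, so the interface \<open>x\<^bsub>i+1/2\<^esub>\<close> is \<open>xf (i + 1)\<close>.
  Cell data are \<open>b i\<close>, \<open>h m i\<close> and \<open>v m i\<close>. The two components of a layer form a vector in
  \<open>real^2\<close>; the product \<open>*\<close> on this type is componentwise, i.e. the Hadamard product.
\<close>

definition cell :: "(int \<Rightarrow> real) \<Rightarrow> int \<Rightarrow> real set" where
  "cell xf i = {xf i .. xf (i + 1)}"

definition Hsurf :: "nat \<Rightarrow> (int \<Rightarrow> real) \<Rightarrow> (nat \<Rightarrow> int \<Rightarrow> real) \<Rightarrow> nat \<Rightarrow> int \<Rightarrow> real" where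
  "Hsurf M b h m i = b i + (\<Sum>k=m..M. h k i)"

text \<open>The values \<open>b\<^sub>\<epsilon>\<^sup>-\<close> and \<open>b\<^sub>\<epsilon>\<^sup>+\<close>, both at the interface between the cells \<open>i\<close> and \<open>i + 1\<close>.\<close>

definition b_minus :: "nat \<Rightarrow> (int \<Rightarrow> real) \<Rightarrow> (nat \<Rightarrow> int \<Rightarrow> real) \<Rightarrow> int \<Rightarrow> real" where
  "b_minus M b h i = min (Hsurf M b h 1 i) (max (b i) (b (i + 1)))"

definition b_plus :: "nat \<Rightarrow> (int \<Rightarrow> real) \<Rightarrow> (nat \<Rightarrow> int \<Rightarrow> real) \<Rightarrow> int \<Rightarrow> real" where
  "b_plus M b h i = min (Hsurf M b h 1 (i + 1)) (max (b i) (b (i + 1)))"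

text \<open>
  The reconstructed quantities are double-valued at the interfaces, hence they take the cell \<open>i\<close> as an
  argument besides the point \<open>x\<close>, which is meant to lie in \<open>cell xf i\<close>; evaluation at a
  face gives the trace from inside cell \<open>i\<close>.
\<close>

definition b_eps ::
  "nat \<Rightarrow> (int \<Rightarrow> real) \<Rightarrow> real \<Rightarrow> (int \<Rightarrow> real) \<Rightarrow> (nat \<Rightarrow> int \<Rightarrow> real) \<Rightarrow> int \<Rightarrow> real \<Rightarrow> real" where
  "b_eps M xf \<epsilon> b h i x =
     (if x \<le> xf i + \<epsilon> then linepath (b_plus M b h (i - 1)) (b i) ((x - xf i) / \<epsilon>)
      else if x \<le> xf (i + 1) - \<epsilon> then b i
      else linepath (b i) (b_minus M b h i) ((x - (xf (i + 1) - \<epsilon>)) / \<epsilon>))"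

definition H_eps ::
  "nat \<Rightarrow> (int \<Rightarrow> real) \<Rightarrow> real \<Rightarrow> (int \<Rightarrow> real) \<Rightarrow> (nat \<Rightarrow> int \<Rightarrow> real) \<Rightarrow> nat \<Rightarrow> int \<Rightarrow> real \<Rightarrow> real" where
  "H_eps M xf \<epsilon> b h m i x = max (Hsurf M b h m i) (b_eps M xf \<epsilon> b h i x)"

definition h_eps ::
  "nat \<Rightarrow> (int \<Rightarrow> real) \<Rightarrow> real \<Rightarrow> (int \<Rightarrow> real) \<Rightarrow> (nat \<Rightarrow> int \<Rightarrow> real) \<Rightarrow> nat \<Rightarrow> int \<Rightarrow> real \<Rightarrow> real" where
  "h_eps M xf \<epsilon> b h m i x =
     (if m = M then H_eps M xf \<epsilon> b h M i x - b_eps M xf \<epsilon> b h i x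
      else H_eps M xf \<epsilon> b h m i x - H_eps M xf \<epsilon> b h (m + 1) i x)"

definition layer_state :: "real \<Rightarrow> real \<Rightarrow> real ^ 2" where
  "layer_state h v = vector [h, h * v]"

text \<open>The full \<open>M\<close>-layer state, the argument of the numerical flux.\<close>

definition u_eps ::
  "nat \<Rightarrow> (int \<Rightarrow> real) \<Rightarrow> real \<Rightarrow> (int \<Rightarrow> real) \<Rightarrow> (nat \<Rightarrow> int \<Rightarrow> real) \<Rightarrow> (nat \<Rightarrow> int \<Rightarrow> real)
     \<Rightarrow> int \<Rightarrow> real \<Rightarrow> nat \<Rightarrow> real ^ 2" where
  "u_eps M xf \<epsilon> b h v i x = (\<lambda>m\<in>{1..M}. layer_state (h_eps M xf \<epsilon> b h m i x) (v m i))"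

definition phi_eps ::
  "real \<Rightarrow> nat \<Rightarrow> (int \<Rightarrow> real) \<Rightarrow> real \<Rightarrow> (int \<Rightarrow> real) \<Rightarrow> (nat \<Rightarrow> int \<Rightarrow> real)
     \<Rightarrow> nat \<Rightarrow> int \<Rightarrow> real \<Rightarrow> real ^ 2" where
  "phi_eps g M xf \<epsilon> b h m i x = g *\<^sub>R vector [0, h_eps M xf \<epsilon> b h m i x]"

definition r_eps ::
  "(nat \<Rightarrow> real) \<Rightarrow> nat \<Rightarrow> (int \<Rightarrow> real) \<Rightarrow> real \<Rightarrow> (int \<Rightarrow> real) \<Rightarrow> (nat \<Rightarrow> int \<Rightarrow> real)
     \<Rightarrow> nat \<Rightarrow> int \<Rightarrow> real \<Rightarrow> real ^ 2" where
  "r_eps \<rho> M xf \<epsilon> b h m i x =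
     vector [0, b_eps M xf \<epsilon> b h i x + (\<Sum>k=m..M. h_eps M xf \<epsilon> b h k i x)
                  + (\<Sum>k=1..<m. \<rho> k / \<rho> m * h_eps M xf \<epsilon> b h k i x)]"

text \<open>
  The derivative is meaningful at all but finitely many points of the cell, see
  \<open>r_eps_piecewise_differentiable\<close> below; at the exceptional points its value is unspecified.
\<close>

definition noncons_volume ::
  "real \<Rightarrow> (nat \<Rightarrow> real) \<Rightarrow> nat \<Rightarrow> (int \<Rightarrow> real) \<Rightarrow> real \<Rightarrow> (int \<Rightarrow> real) \<Rightarrow> (nat \<Rightarrow> int \<Rightarrow> real)
     \<Rightarrow> nat \<Rightarrow> int \<Rightarrow> real \<Rightarrow> real ^ 2" where
  "noncons_volume g \<rho> M xf \<epsilon> b h m i x =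
     phi_eps g M xf \<epsilon> b h m i x *
     vector_derivative (r_eps \<rho> M xf \<epsilon> b h m i) (at x within cell xf i)"

text \<open>The numerical nonconservative term at the point \<open>x\<close> for inner cell \<open>i\<close> and outer cell \<open>j\<close>.\<close>

definition noncons_surface ::
  "real \<Rightarrow> (nat \<Rightarrow> real) \<Rightarrow> nat \<Rightarrow> (int \<Rightarrow> real) \<Rightarrow> real \<Rightarrow> (int \<Rightarrow> real) \<Rightarrow> (nat \<Rightarrow> int \<Rightarrow> real)
     \<Rightarrow> nat \<Rightarrow> int \<Rightarrow> int \<Rightarrow> real \<Rightarrow> real ^ 2" where
  "noncons_surface g \<rho> M xf \<epsilon> b h m i j x =
     (1/2) *\<^sub>R (phi_eps g M xf \<epsilon> b h m i x *
       (r_eps \<rho> M xf \<epsilon> b h m j x - r_eps \<rho> M xf \<epsilon> b h m i x))"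

text \<open>
  The numerical flux \<open>fstar\<close> takes the left and the right state of the interface. In one
  dimension the boundary integral is the sum over the two faces, with outward normal \<open>1\<close> at the
  right and \<open>-1\<close> at the left one.
\<close>

definition surface_integral ::
  "((nat \<Rightarrow> real ^ 2) \<Rightarrow> (nat \<Rightarrow> real ^ 2) \<Rightarrow> nat \<Rightarrow> real ^ 2) \<Rightarrow> real \<Rightarrow> (nat \<Rightarrow> real) \<Rightarrow> nat
     \<Rightarrow> (int \<Rightarrow> real) \<Rightarrow> real \<Rightarrow> (int \<Rightarrow> real) \<Rightarrow> (nat \<Rightarrow> int \<Rightarrow> real) \<Rightarrow> (nat \<Rightarrow> int \<Rightarrow> real)
     \<Rightarrow> nat \<Rightarrow> int \<Rightarrow> real ^ 2" where
  "surface_integral fstar g \<rho> M xf \<epsilon> b h v m i =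
     (let xl = xf i; xr = xf (i + 1); u = u_eps M xf \<epsilon> b h v in
       1 *\<^sub>R (fstar (u i xr) (u (i + 1) xr) m + noncons_surface g \<rho> M xf \<epsilon> b h m i (i + 1) xr)
       + (-1) *\<^sub>R (fstar (u (i - 1) xl) (u i xl) m + noncons_surface g \<rho> M xf \<epsilon> b h m i (i - 1) xl))"


lemma max_affine_piecewise_differentiable:
  fixes a c d :: real
  shows "(\<lambda>x. max c (a * x + d)) piecewise_differentiable_on S"
proof (cases "a = 0")
  case False
  have "(\<lambda>x. max c (a * x + d)) differentiable at x within S" if "x \<noteq> (c - d) / a" for x
  proof -
    have ne: "a * x + d \<noteq> c" using that False by (auto simp: field_simps)
    have o: "open {y. a * y + d < c}" "open {y. c < a * y + d}"
      by (intro open_Collect_less continuous_intros)+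
    have "\<exists>D. ((\<lambda>x. max c (a * x + d)) has_derivative D) (at x within S)"
    proof (cases "a * x + d < c")
      case True
      have "((\<lambda>x. c) has_derivative (\<lambda>_. 0)) (at x within S)" by simp
      then have "((\<lambda>x. max c (a * x + d)) has_derivative (\<lambda>_. 0)) (at x within S)"
        by (rule has_derivative_transform_within_open[OF _ o(1)]) (use True in auto)
      then show ?thesis by (intro exI)
    next
      case g: False
      have "((\<lambda>x. a * x + d) has_derivative (\<lambda>y. a * y)) (at x within S)"
        by (auto intro!: derivative_eq_intros)
      then have "((\<lambda>x. max c (a * x + d)) has_derivative (\<lambda>y. a * y)) (at x within S)"
        by (rule has_derivative_transform_within_open[OF _ o(2)]) (use g ne in auto)
      then show ?thesis by (intro exI)
    qed
    then show ?thesis by (simp add: differentiable_def)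
  qed
  moreover have "continuous_on S (\<lambda>x. max c (a * x + d))" by (intro continuous_intros)
  ultimately show ?thesis
    unfolding piecewise_differentiable_on_def
    by (intro conjI exI[of _ "{(c - d) / a}"]) auto
qed simp

lemma max_linepath_piecewise_differentiable:
  fixes c p q l e :: real
  shows "(\<lambda>x. max c (linepath p q ((x - l) / e))) piecewise_differentiable_on S"
proof -
  have "linepath p q ((x - l) / e) = (q - p) / e * x + (p - (q - p) / e * l)" for x
    by (simp add: linepath_def diff_divide_distrib algebra_simps)
  then show ?thesis by (simp only: max_affine_piecewise_differentiable)
qed

lemma max_b_eps_piecewise_differentiable:
  assumes "0 < \<epsilon>" "\<epsilon> < dx / 2" "xf (i + 1) = xf i + dx"
  shows "(\<lambda>x. max c (b_eps M xf \<epsilon> b h i x)) piecewise_differentiable_on cell xf i"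
proof -
  let ?l = "\<lambda>x. max c (linepath (b_plus M b h (i - 1)) (b i) ((x - xf i) / \<epsilon>))"
  let ?r = "\<lambda>x. max c (linepath (b i) (b_minus M b h i) ((x - (xf (i + 1) - \<epsilon>)) / \<epsilon>))"
  have "(\<lambda>x. if x \<le> xf i + \<epsilon> then ?l x
          else if x \<le> xf (i + 1) - \<epsilon> then max c (b i) else ?r x)
        piecewise_differentiable_on {xf i .. xf (i + 1)}"
    using assms
    by (intro piecewise_differentiable_cases max_linepath_piecewise_differentiable
          piecewise_differentiable_const) (auto simp: linepath_def)
  also have "(\<lambda>x. if x \<le> xf i + \<epsilon> then ?l x
          else if x \<le> xf (i + 1) - \<epsilon> then max c (b i) else ?r x)
      = (\<lambda>x. max c (b_eps M xf \<epsilon> b h i x))"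
    by (auto simp: b_eps_def)
  finally show ?thesis by (simp add: cell_def)
qed

lemma b_eps_piecewise_differentiable:
  assumes "0 < \<epsilon>" "\<epsilon> < dx / 2" "xf (i + 1) = xf i + dx"
  shows "b_eps M xf \<epsilon> b h i piecewise_differentiable_on cell xf i"
proof -
  let ?l = "linepath (b_plus M b h (i - 1)) (b i)" and ?r = "linepath (b i) (b_minus M b h i)"
  have d: "(\<lambda>x. linepath p q ((x - z) / \<epsilon>)) piecewise_differentiable_on S" for p q z :: real and S
    unfolding linepath_def using assms(1)
    by (intro differentiable_imp_piecewise_differentiable) (auto intro!: derivative_intros)
  have "(\<lambda>x. if x \<le> xf i + \<epsilon> then ?l ((x - xf i) / \<epsilon>)
          else if x \<le> xf (i + 1) - \<epsilon> then b i else ?r ((x - (xf (i + 1) - \<epsilon>)) / \<epsilon>))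
        piecewise_differentiable_on {xf i .. xf (i + 1)}"
    using assms
    by (intro piecewise_differentiable_cases d piecewise_differentiable_const)
      (auto simp: linepath_def)
  then show ?thesis by (simp add: cell_def b_eps_def[abs_def])
qed

lemma sum_piecewise_differentiable:
  fixes f :: "'a \<Rightarrow> real \<Rightarrow> real"
  assumes "\<And>k. f k piecewise_differentiable_on S"
  shows "(\<lambda>x. \<Sum>k\<in>A. c k * f k x) piecewise_differentiable_on S"
proof (induction A rule: infinite_finite_induct)
  case (insert k A)
  have "(\<lambda>x. c k * f k x) piecewise_differentiable_on S"
    using assms[of k] by (fastforce simp: piecewise_differentiable_on_def
        intro!: continuous_intros derivative_intros)
  from piecewise_differentiable_add[OF this insert.IH] show ?case
    using insert.hyps by simp
qed simp_all

lemma r_eps_piecewise_differentiable: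
  assumes "0 < \<epsilon>" "\<epsilon> < dx / 2" "xf (i + 1) = xf i + dx"
  shows "r_eps \<rho> M xf \<epsilon> b h m i piecewise_differentiable_on cell xf i"
proof -
  note max_b = max_b_eps_piecewise_differentiable[where \<epsilon> = \<epsilon> and dx = dx, OF assms]
  note b = b_eps_piecewise_differentiable[where \<epsilon> = \<epsilon> and dx = dx, OF assms]
  have h: "h_eps M xf \<epsilon> b h k i piecewise_differentiable_on cell xf i" for k
    unfolding h_eps_def[abs_def] H_eps_def
    by (cases "k = M") (simp_all add: piecewise_differentiable_diff max_b b)
  define s where "s = (\<lambda>x. b_eps M xf \<epsilon> b h i x + (\<Sum>k=m..M. h_eps M xf \<epsilon> b h k i x)
    + (\<Sum>k=1..<m. \<rho> k / \<rho> m * h_eps M xf \<epsilon> b h k i x))"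
  have "s piecewise_differentiable_on cell xf i"
    unfolding s_def
    using sum_piecewise_differentiable[OF h, where c = "\<lambda>_. 1"]
      sum_piecewise_differentiable[OF h, where c = "\<lambda>k. \<rho> k / \<rho> m"]
    by (intro piecewise_differentiable_add b) simp_all
  then have "(\<lambda>x. s x *\<^sub>R (vector [0, 1] :: real ^ 2)) piecewise_differentiable_on cell xf i"
    by (fastforce simp: piecewise_differentiable_on_def intro!: continuous_intros derivative_intros)
  also have "(\<lambda>x. s x *\<^sub>R vector [0, 1]) = r_eps \<rho> M xf \<epsilon> b h m i"
    by (auto simp: r_eps_def s_def vec_eq_iff forall_2)
  finally show ?thesis .
qed

end

theory Submission
  imports Defs
begin

text \<open>
  The integrand vanishes at every point of the cell. Let \<open>x\<close> be a point where layer \<open>m\<close> of the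
  reconstruction is present, that is \<open>h\<^bsub>m,\<epsilon>\<^esub>(x) \<noteq> 0\<close>. Then the reconstructed bottom lies strictly
  below the surface \<open>H\<^bsub>m,i\<^esub>\<close> at \<open>x\<close> and, being continuous, also near \<open>x\<close>. As the layer heights are
  nonnegative, \<open>H\<^bsub>k,i\<^esub> \<ge> H\<^bsub>m,i\<^esub>\<close> for \<open>k \<le> m\<close>, so near \<open>x\<close> the maximum in \<open>H\<^bsub>k,\<epsilon>\<^esub>\<close> is inactive and
  \<open>H\<^bsub>k,\<epsilon>\<^esub> = H\<^bsub>k,i\<^esub>\<close> for all \<open>k \<le> m\<close>. Telescoping gives
  \<open>b\<^sub>\<epsilon> + (\<Sum>k\<ge>m. h\<^bsub>k,\<epsilon>\<^esub>) = H\<^bsub>m,\<epsilon>\<^esub>\<close>, hence \<open>r\<^bsub>m,\<epsilon>\<^esub>\<close> depends on the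
  \<open>H\<^bsub>k,\<epsilon>\<^esub>\<close> with \<open>k \<le> m\<close> only. It is therefore locally constant, and its derivative
  is zero. Where layer \<open>m\<close> is dry, \<open>\<phi>\<^bsub>m,\<epsilon>\<^esub>\<close> is zero.
\<close>

lemma Hsurf_antimono:
  assumes "k \<le> m" and "\<And>j. j \<in> {k..M} \<Longrightarrow> h j i \<ge> 0"
  shows "Hsurf M b h m i \<le> Hsurf M b h k i"
  using assms by (auto simp: Hsurf_def intro!: sum_mono2)

lemma sum_h_eps_telescope:
  assumes "m \<le> M"
  shows "b_eps M xf \<epsilon> b h i x + (\<Sum>k=m..M. h_eps M xf \<epsilon> b h k i x) = H_eps M xf \<epsilon> b h m i x"
  using assms
proof (induction rule: inc_induct)
  case base
  then show ?case by (simp add: h_eps_def)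
next
  case (step n)
  then have "(\<Sum>k=n..M. h_eps M xf \<epsilon> b h k i x)
      = h_eps M xf \<epsilon> b h n i x + (\<Sum>k=Suc n..M. h_eps M xf \<epsilon> b h k i x)"
    by (intro sum.atLeast_Suc_atMost) simp
  with step show ?case by (simp add: h_eps_def)
qed

lemma h_eps_nonzero_imp_b_eps_less:
  assumes "m \<le> M" and "\<And>j. j \<in> {m..M} \<Longrightarrow> h j i \<ge> 0" and "h_eps M xf \<epsilon> b h m i x \<noteq> 0"
  shows "b_eps M xf \<epsilon> b h i x < Hsurf M b h m i"
proof (rule ccontr)
  assume le: "\<not> ?thesis"
  have "Hsurf M b h (m + 1) i \<le> Hsurf M b h m i"
    using assms(2) by (intro Hsurf_antimono) auto
  with le assms(3) show False
    by (auto simp: h_eps_def H_eps_def split: if_splits)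
qed

text \<open>Where the bottom lies below \<open>H\<^bsub>m,i\<^esub>\<close>, \<open>r\<^bsub>m,\<epsilon>\<^esub>\<close> does not depend on the position.\<close>

lemma r_eps_below_surface:
  assumes "m \<le> M" and "\<And>j. j \<in> {1..M} \<Longrightarrow> h j i \<ge> 0"
    and "b_eps M xf \<epsilon> b h i x < Hsurf M b h m i"
  shows "r_eps \<rho> M xf \<epsilon> b h m i x =
    vector [0, Hsurf M b h m i
      + (\<Sum>k=1..<m. \<rho> k / \<rho> m * (Hsurf M b h k i - Hsurf M b h (k + 1) i))]"
proof -
  have H: "H_eps M xf \<epsilon> b h k i x = Hsurf M b h k i" if "1 \<le> k" "k \<le> m" for k
  proof -
    have "Hsurf M b h m i \<le> Hsurf M b h k i"
      using that assms(2) by (intro Hsurf_antimono) auto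
    with assms(3) show ?thesis by (simp add: H_eps_def)
  qed
  have "H_eps M xf \<epsilon> b h m i x = Hsurf M b h m i"
    using assms(3) by (simp add: H_eps_def)
  moreover have "h_eps M xf \<epsilon> b h k i x = Hsurf M b h k i - Hsurf M b h (k + 1) i"
    if "k \<in> {1..<m}" for k
    using that assms(1) H[of k] H[of "k + 1"] by (auto simp: h_eps_def)
  ultimately show ?thesis
    by (simp add: r_eps_def sum_h_eps_telescope[OF assms(1)])
qed

lemma noncons_volume_eq_0:
  assumes "0 < \<epsilon>" "\<epsilon> < dx / 2" "xf (i + 1) = xf i + dx"
    and "m \<le> M" and nonneg: "\<And>j. j \<in> {1..M} \<Longrightarrow> h j i \<ge> 0"
    and "1 \<le> m" and x: "x \<in> cell xf i"
  shows "noncons_volume g \<rho> M xf \<epsilon> b h m i x = 0"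
proof (cases "h_eps M xf \<epsilon> b h m i x = 0")
  case True
  then show ?thesis
    by (simp add: noncons_volume_def phi_eps_def vec_eq_iff forall_2)
next
  case False
  then have below: "b_eps M xf \<epsilon> b h i x < Hsurf M b h m i"
    using assms by (intro h_eps_nonzero_imp_b_eps_less) auto
  have "continuous_on (cell xf i) (b_eps M xf \<epsilon> b h i)"
    using b_eps_piecewise_differentiable[where \<epsilon> = \<epsilon> and dx = dx, OF assms(1-3)]
    by (simp add: piecewise_differentiable_on_def)
  then have "(b_eps M xf \<epsilon> b h i \<longlongrightarrow> b_eps M xf \<epsilon> b h i x) (at x within cell xf i)"
    using x by (simp add: continuous_on)
  from order_tendstoD(2)[OF this below]
  have "eventually (\<lambda>y. b_eps M xf \<epsilon> b h i y < Hsurf M b h m i) (at x within cell xf i)" .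
  then have "eventually (\<lambda>y. r_eps \<rho> M xf \<epsilon> b h m i y = r_eps \<rho> M xf \<epsilon> b h m i x)
      (at x within cell xf i)"
    by eventually_elim (simp only: r_eps_below_surface[where h = h and i = i, OF assms(4) nonneg] below)
  then have "(r_eps \<rho> M xf \<epsilon> b h m i has_derivative (\<lambda>_. 0)) (at x within cell xf i)"
    using x by (intro has_derivative_transform_eventually[OF has_derivative_const])
      (auto elim: eventually_mono)
  then have "(r_eps \<rho> M xf \<epsilon> b h m i has_vector_derivative 0) (at x within cell xf i)"
    by (simp add: has_vector_derivative_def)
  then have "vector_derivative (r_eps \<rho> M xf \<epsilon> b h m i) (at x within cell xf i) = 0"
    using x assms(1-3) unfolding cell_def
    by (intro vector_derivative_within_closed_interval) auto
  then show ?thesis by (simp add: noncons_volume_def)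
qed

theorem lemma1:
  fixes g dx \<epsilon> :: real and M :: nat and \<rho> :: "nat \<Rightarrow> real"
    and xf b :: "int \<Rightarrow> real"
    and fstar :: "(nat \<Rightarrow> real ^ 2) \<Rightarrow> (nat \<Rightarrow> real ^ 2) \<Rightarrow> nat \<Rightarrow> real ^ 2"
    and T :: "real set" and h v :: "real \<Rightarrow> nat \<Rightarrow> int \<Rightarrow> real"
  assumes "M \<ge> 1" and "g > 0"
    and "0 < \<rho> 1" and "strict_mono_on {1..M} \<rho>"
    and "\<forall>i. xf (i + 1) = xf i + dx"
    and "0 < \<epsilon>" and "\<epsilon> < dx / 2"
    and "\<forall>t\<in>T. \<forall>m\<in>{1..M}. \<forall>i. h t m i \<ge> 0"
  shows "\<forall>t\<in>T. \<forall>i. \<forall>m\<in>{1..M}.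
    (noncons_volume g \<rho> M xf \<epsilon> b (h t) m i has_integral 0) (cell xf i) \<and>
    (((\<lambda>s. layer_state (h s m i) (v s m i)) has_vector_derivative
        - (1 / dx) *\<^sub>R surface_integral fstar g \<rho> M xf \<epsilon> b (h t) (v t) m i
        - (1 / dx) *\<^sub>R integral (cell xf i) (noncons_volume g \<rho> M xf \<epsilon> b (h t) m i))
        (at t within T)
     \<longleftrightarrow>
     ((\<lambda>s. layer_state (h s m i) (v s m i)) has_vector_derivative
        - (1 / dx) *\<^sub>R surface_integral fstar g \<rho> M xf \<epsilon> b (h t) (v t) m i)
        (at t within T))"
proof (intro ballI allI)
  fix t i m
  assume "t \<in> T" and "m \<in> {1..M}"
  then have "noncons_volume g \<rho> M xf \<epsilon> b (h t) m i x = 0" if "x \<in> cell xf i" for x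
    using assms that by (intro noncons_volume_eq_0[where dx = dx]) auto
  then have int0: "(noncons_volume g \<rho> M xf \<epsilon> b (h t) m i has_integral 0) (cell xf i)"
    by (rule has_integral_is_0)
  then show "(noncons_volume g \<rho> M xf \<epsilon> b (h t) m i has_integral 0) (cell xf i) \<and>
    (((\<lambda>s. layer_state (h s m i) (v s m i)) has_vector_derivative
        - (1 / dx) *\<^sub>R surface_integral fstar g \<rho> M xf \<epsilon> b (h t) (v t) m i
        - (1 / dx) *\<^sub>R integral (cell xf i) (noncons_volume g \<rho> M xf \<epsilon> b (h t) m i))
        (at t within T)
     \<longleftrightarrow>
     ((\<lambda>s. layer_state (h s m i) (v s m i)) has_vector_derivative
        - (1 / dx) *\<^sub>R surface_integral fstar g \<rho> M xf \<epsilon> b (h t) (v t) m i)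
        (at t within T))"
    by (simp add: integral_unique)
qed

end
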